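(* The Onsager algebra is isomorphic to the Lie subalgebra of the $\mathfrak{sl}_2$-loop algebra $\mathcal{L}$ fixed by the Chevalley involution $\omega$; i.e., $\mathcal{O}\cong\mathcal{L}^{\omega}$ as Lie algebras over $k$.
   Context: $k$ is an algebraically closed field of characteristic zero. The Onsager algebra $\mathcal{O}$ is the Lie algebra over $k$ with basis $\{A_m, G_l \mid m\in\mathbb{Z},\ l\in\mathbb{N}_+\}$, where $\mathbb{N}_+=\{1,2,\dots\}$, and antisymmetric bilinear product given by $[A_l,A_m]=2G_{l-m}$ for $l>m$, $[G_l,A_m]=A_{m+l}-A_{m-l}$, $[G_l,G_m]=0$. Let $e,f,h$ be the standard basis of $\mathfrak{sl}_2=\mathfrak{sl}_2(k)$, with $[e,f]=h$, $[h,e]=2e$, $[h,f]=-2f$. Let $\mathcal{L}=k[t,t^{-1}]\otimes_k\mathfrak{sl}_2$ with bracket $[p\otimes x,q\otimes y]=pq\otimes[x,y]$. The Chevalley involution on $\mathfrak{sl}_2$ is the automorphism $x\mapsto\overline{x}$ with $\overline{e}=f$, $\overline{f}=e$, $\overline{h}=-h$; it induces the involution $\omega$ of $\mathcal{L}$ given by $\omega(p(t)\otimes x)=p(t^{-1})\otimes\overline{x}$. Then $\mathcal{L}^{\omega}=\{X\in\mathcal{L}\mid\omega(X)=X\}$. *)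

theory Defs
  imports
    "HOL-Computational_Algebra.Polynomial"
    "HOL-Analysis.Determinants"
    "HOL-Library.Poly_Mapping"
begin

section \<open>Lie algebras over a field\<close>

locale lie_algebra = vector_space scale
  for scale :: "'k::field \<Rightarrow> 'a::ab_group_add \<Rightarrow> 'a" +
  fixes bracket :: "'a \<Rightarrow> 'a \<Rightarrow> 'a"
  assumes bracket_add_left: "bracket (x + y) z = bracket x z + bracket y z"
    and bracket_add_right: "bracket x (y + z) = bracket x y + bracket x z"
    and bracket_scale_left: "bracket (scale c x) y = scale c (bracket x y)"
    and bracket_scale_right: "bracket x (scale c y) = scale c (bracket x y)"
    and bracket_self: "bracket x x = 0"
    and jacobi: "bracket x (bracket y z) + bracket y (bracket z x) + bracket z (bracket x y) = 0"
begin

definition lie_subalgebra :: "'a set \<Rightarrow> bool" where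
  "lie_subalgebra S \<longleftrightarrow> subspace S \<and> (\<forall>x\<in>S. \<forall>y\<in>S. bracket x y \<in> S)"

end

text \<open>The Lie algebra formed by a whole type is isomorphic to the Lie subalgebra \<open>S\<close> of
  another one.\<close>

definition lie_isomorphic_to_subalgebra ::
    "('k::field \<Rightarrow> 'a::ab_group_add \<Rightarrow> 'a) \<Rightarrow> ('a \<Rightarrow> 'a \<Rightarrow> 'a) \<Rightarrow>
     ('k \<Rightarrow> 'b::ab_group_add \<Rightarrow> 'b) \<Rightarrow> ('b \<Rightarrow> 'b \<Rightarrow> 'b) \<Rightarrow> 'b set \<Rightarrow> bool" where
  "lie_isomorphic_to_subalgebra s1 b1 s2 b2 S \<longleftrightarrow>
     lie_algebra s1 b1 \<and> lie_algebra s2 b2 \<and> lie_algebra.lie_subalgebra s2 b2 S \<and>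
     (\<exists>\<phi>. Vector_Spaces.linear s1 s2 \<phi> \<and>
          (\<forall>x y. \<phi> (b1 x y) = b2 (\<phi> x) (\<phi> y)) \<and>
          bij_betw \<phi> UNIV S)"


section \<open>Finitely supported functions\<close>

definition biadditive_ext ::
    "('i \<Rightarrow> 'j \<Rightarrow> 'a::zero \<Rightarrow> 'b::zero \<Rightarrow> 'c::comm_monoid_add) \<Rightarrow> ('i \<Rightarrow>\<^sub>0 'a) \<Rightarrow> ('j \<Rightarrow>\<^sub>0 'b) \<Rightarrow> 'c" where
  "biadditive_ext F x y =
     (\<Sum>i\<in>Poly_Mapping.keys x. \<Sum>j\<in>Poly_Mapping.keys y.
        F i j (Poly_Mapping.lookup x i) (Poly_Mapping.lookup y j))"

lemma poly_mapping_add_induct [case_names zero single add]: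
  fixes p :: "'i \<Rightarrow>\<^sub>0 'a::comm_monoid_add"
  assumes "P 0" "\<And>i a. P (Poly_Mapping.single i a)" "\<And>x y. P x \<Longrightarrow> P y \<Longrightarrow> P (x + y)"
  shows "P p"
proof (induction p rule: update_induct)
  case const
  then show ?case using assms(1) by simp
next
  case (update f a b)
  have "Poly_Mapping.update a b f = f + Poly_Mapping.single a b"
    using update(1)
    by (intro poly_mapping_eqI)
       (auto simp: lookup_update lookup_add lookup_single when_def in_keys_iff)
  then show ?case using assms(2,3) update by simp
qed

lemma biadditive_ext_superset:
  assumes "finite I" "Poly_Mapping.keys x \<subseteq> I" "finite J" "Poly_Mapping.keys y \<subseteq> J"
    and "\<And>i j b. F i j 0 b = 0" "\<And>i j a. F i j a 0 = 0"
  shows "biadditive_ext F x y =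
    (\<Sum>i\<in>I. \<Sum>j\<in>J. F i j (Poly_Mapping.lookup x i) (Poly_Mapping.lookup y j))"
proof -
  have "biadditive_ext F x y = (\<Sum>i\<in>Poly_Mapping.keys x. \<Sum>j\<in>J.
        F i j (Poly_Mapping.lookup x i) (Poly_Mapping.lookup y j))"
    unfolding biadditive_ext_def
    by (intro sum.cong refl sum.mono_neutral_left) (use assms in \<open>auto simp: in_keys_iff\<close>)
  also have "\<dots> = (\<Sum>i\<in>I. \<Sum>j\<in>J. F i j (Poly_Mapping.lookup x i) (Poly_Mapping.lookup y j))"
    by (intro sum.mono_neutral_left) (use assms in \<open>auto simp: in_keys_iff\<close>)
  finally show ?thesis .
qed

lemma biadditive_ext_add_left:
  fixes x x' :: "'i \<Rightarrow>\<^sub>0 'a::ab_group_add" and y :: "'j \<Rightarrow>\<^sub>0 'b::ab_group_add"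
    and F :: "'i \<Rightarrow> 'j \<Rightarrow> 'a \<Rightarrow> 'b \<Rightarrow> 'c::ab_group_add"
  assumes add1: "\<And>i j a a' b. F i j (a + a') b = F i j a b + F i j a' b"
    and add2: "\<And>i j a b b'. F i j a (b + b') = F i j a b + F i j a b'"
  shows "biadditive_ext F (x + x') y = biadditive_ext F x y + biadditive_ext F x' y"
proof -
  have z: "F i j 0 b = 0" "F i j a 0 = 0" for i j a b
    using add1[of i j 0 0 b] add2[of i j a 0 0] by auto
  let ?I = "Poly_Mapping.keys x \<union> Poly_Mapping.keys x'"
  have I: "finite ?I" "Poly_Mapping.keys (x + x') \<subseteq> ?I"
    "Poly_Mapping.keys x \<subseteq> ?I" "Poly_Mapping.keys x' \<subseteq> ?I"
    using keys_add[of x x'] by auto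
  show ?thesis
    by (simp add: biadditive_ext_superset[where F=F, OF I(1,2) finite_keys order_refl z]
      biadditive_ext_superset[where F=F, OF I(1,3) finite_keys order_refl z]
      biadditive_ext_superset[where F=F, OF I(1,4) finite_keys order_refl z]
      lookup_add add1 sum.distrib)
qed

lemma biadditive_ext_add_right:
  fixes x :: "'i \<Rightarrow>\<^sub>0 'a::ab_group_add" and y y' :: "'j \<Rightarrow>\<^sub>0 'b::ab_group_add"
    and F :: "'i \<Rightarrow> 'j \<Rightarrow> 'a \<Rightarrow> 'b \<Rightarrow> 'c::ab_group_add"
  assumes add1: "\<And>i j a a' b. F i j (a + a') b = F i j a b + F i j a' b"
    and add2: "\<And>i j a b b'. F i j a (b + b') = F i j a b + F i j a b'"
  shows "biadditive_ext F x (y + y') = biadditive_ext F x y + biadditive_ext F x y'"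
proof -
  have z: "F i j 0 b = 0" "F i j a 0 = 0" for i j a b
    using add1[of i j 0 0 b] add2[of i j a 0 0] by auto
  let ?I = "Poly_Mapping.keys y \<union> Poly_Mapping.keys y'"
  have I: "finite ?I" "Poly_Mapping.keys (y + y') \<subseteq> ?I"
    "Poly_Mapping.keys y \<subseteq> ?I" "Poly_Mapping.keys y' \<subseteq> ?I"
    using keys_add[of y y'] by auto
  show ?thesis
    by (simp add: biadditive_ext_superset[where F=F, OF finite_keys order_refl I(1,2) z]
      biadditive_ext_superset[where F=F, OF finite_keys order_refl I(1,3) z]
      biadditive_ext_superset[where F=F, OF finite_keys order_refl I(1,4) z]
      lookup_add add2 sum.distrib)
qed

lemma biadditive_ext_single:
  assumes "\<And>b. F i j 0 b = 0" "\<And>a. F i j a 0 = 0"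
  shows "biadditive_ext F (Poly_Mapping.single i a) (Poly_Mapping.single j b) = F i j a b"
  using assms by (simp add: biadditive_ext_def)

lemma biadditive_ext_zero [simp]: "biadditive_ext F 0 y = 0" "biadditive_ext F x 0 = 0"
  by (simp_all add: biadditive_ext_def)

lemma lookup_map_zero:
  "f 0 = 0 \<Longrightarrow> Poly_Mapping.lookup (Poly_Mapping.map f p) i = f (Poly_Mapping.lookup p i)"
  by (simp add: Poly_Mapping.map.rep_eq when_def)


section \<open>The Onsager algebra\<close>

typedef pnat = "{n::nat. 0 < n}"
  by auto

datatype onsager_index = A_index int | G_index pnat

type_synonym 'k onsager = "onsager_index \<Rightarrow>\<^sub>0 'k"

definition A_elt :: "int \<Rightarrow> 'k::field onsager" where
  "A_elt m = Poly_Mapping.single (A_index m) 1"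

text \<open>Meaningful for \<open>l > 0\<close> only.\<close>

definition G_elt :: "nat \<Rightarrow> 'k::field onsager" where
  "G_elt l = Poly_Mapping.single (G_index (Abs_pnat l)) 1"

definition onsager_scale :: "'k::field \<Rightarrow> 'k onsager \<Rightarrow> 'k onsager" where
  "onsager_scale c = Poly_Mapping.map ((*) c)"

fun onsager_basis_bracket :: "onsager_index \<Rightarrow> onsager_index \<Rightarrow> 'k::field onsager" where
  "onsager_basis_bracket (A_index l) (A_index m) =
     (if m < l then onsager_scale 2 (G_elt (nat (l - m)))
      else if l < m then - onsager_scale 2 (G_elt (nat (m - l)))
      else 0)"
| "onsager_basis_bracket (G_index l) (A_index m) =
     A_elt (m + int (Rep_pnat l)) - A_elt (m - int (Rep_pnat l))"
| "onsager_basis_bracket (A_index m) (G_index l) =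
     - (A_elt (m + int (Rep_pnat l)) - A_elt (m - int (Rep_pnat l)))"
| "onsager_basis_bracket (G_index l) (G_index m) = 0"

definition onsager_bracket :: "'k::field onsager \<Rightarrow> 'k onsager \<Rightarrow> 'k onsager" where
  "onsager_bracket =
     biadditive_ext (\<lambda>i j a b. onsager_scale (a * b) (onsager_basis_bracket i j))"

lemma lookup_onsager_scale [simp]:
  "Poly_Mapping.lookup (onsager_scale c x) i = c * Poly_Mapping.lookup x i"
  by (simp add: onsager_scale_def lookup_map_zero)

lemma vector_space_onsager: "vector_space (onsager_scale :: 'k::field \<Rightarrow> _)"
  by standard (auto intro!: poly_mapping_eqI simp: lookup_add algebra_simps)

interpretation onsager: vector_space "onsager_scale :: 'k::field \<Rightarrow> _"
  by (rule vector_space_onsager)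

lemma onsager_bracket_add:
  "onsager_bracket (x + y) z = onsager_bracket x z + onsager_bracket y z"
  "onsager_bracket x (y + z) = onsager_bracket x y + onsager_bracket x z"
  unfolding onsager_bracket_def
  by (intro biadditive_ext_add_left biadditive_ext_add_right;
      simp add: distrib_left distrib_right onsager.scale_left_distrib)+

lemma onsager_bracket_zero [simp]: "onsager_bracket 0 y = 0" "onsager_bracket x 0 = 0"
  by (simp_all add: onsager_bracket_def)

lemma onsager_bracket_minus [simp]:
  "onsager_bracket (- x) y = - onsager_bracket x y"
  "onsager_bracket x (- y) = - onsager_bracket x y"
  using onsager_bracket_add(1)[of x "- x" y] onsager_bracket_add(2)[of x y "- y"]
  by (simp_all add: eq_neg_iff_add_eq_0 add.commute)

lemma onsager_bracket_diff:
  "onsager_bracket (x - y) z = onsager_bracket x z - onsager_bracket y z"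
  "onsager_bracket x (y - z) = onsager_bracket x y - onsager_bracket x z"
  using onsager_bracket_add(1)[of x "- y" z] onsager_bracket_add(2)[of x y "- z"] by simp_all

lemma onsager_bracket_single:
  "onsager_bracket (Poly_Mapping.single i a) (Poly_Mapping.single j b) =
     onsager_scale (a * b) (onsager_basis_bracket i j)"
  unfolding onsager_bracket_def by (rule biadditive_ext_single) simp_all

lemma onsager_scale_single:
  "onsager_scale c (Poly_Mapping.single i a) = Poly_Mapping.single i (c * a)"
  by (simp add: onsager_scale_def)

lemma onsager_bracket_scale_left:
  "onsager_bracket (onsager_scale c x) y = onsager_scale c (onsager_bracket x y)"
proof (induction x rule: poly_mapping_add_induct)
  case zero show ?case by simp
next
  case (add x x')
  then show ?case by (simp add: onsager.scale_right_distrib onsager_bracket_add)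
next
  case (single i a)
  show ?case
    by (induction y rule: poly_mapping_add_induct)
       (simp_all add: onsager.scale_right_distrib onsager_bracket_add onsager_scale_single
         onsager_bracket_single mult.assoc)
qed

lemma onsager_basis_bracket_antisym:
  "onsager_basis_bracket i j = - (onsager_basis_bracket j i :: 'k::field onsager)"
  by (cases i; cases j) auto

lemma onsager_bracket_antisym: "onsager_bracket x y = - onsager_bracket y x"
proof (induction x rule: poly_mapping_add_induct)
  case zero show ?case by simp
next
  case (add x x')
  then show ?case by (simp add: onsager_bracket_add)
next
  case (single i a)
  show ?case
  proof (induction y rule: poly_mapping_add_induct)
    case (single j b)
    show ?case
      by (simp add: onsager_bracket_single mult.commute
          onsager_basis_bracket_antisym[of i j] onsager.scale_minus_right)
  qed (simp_all add: onsager_bracket_add)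
qed

lemma onsager_bracket_scale_right:
  "onsager_bracket x (onsager_scale c y) = onsager_scale c (onsager_bracket x y)"
  using onsager_bracket_scale_left[of c y x] onsager_bracket_antisym[of x y]
    onsager_bracket_antisym[of x "onsager_scale c y"] by simp

lemma onsager_bracket_self: "onsager_bracket x x = 0"
proof (induction x rule: poly_mapping_add_induct)
  case (single i a)
  show ?case by (cases i) (simp_all add: onsager_bracket_single)
next
  case (add x y)
  then show ?case
    using onsager_bracket_antisym[of x y] by (simp add: onsager_bracket_add)
qed simp

lemma onsager_bracket_A_A:
  "m < l \<Longrightarrow> onsager_bracket (A_elt l) (A_elt m) = onsager_scale 2 (G_elt (nat (l - m)))"
  by (simp add: A_elt_def onsager_bracket_single)

lemma onsager_bracket_G_A:
  "0 < l \<Longrightarrow> onsager_bracket (G_elt l) (A_elt m) = A_elt (m + int l) - A_elt (m - int l)"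
  by (simp add: A_elt_def G_elt_def onsager_bracket_single Abs_pnat_inverse)

lemma onsager_bracket_G_G: "onsager_bracket (G_elt l) (G_elt m) = 0"
  by (simp add: G_elt_def onsager_bracket_single)

text \<open>The convention \<open>G\<^sub>0 = 0\<close>, \<open>G\<^sub>-\<^sub>l = - G\<^sub>l\<close> makes the relations uniform in all indices.\<close>

definition G_int :: "int \<Rightarrow> 'k::field onsager" where
  "G_int l = (if 0 < l then G_elt (nat l) else if l < 0 then - G_elt (nat (- l)) else 0)"

lemma onsager_bracket_int:
  "onsager_bracket (A_elt l) (A_elt m) = onsager_scale 2 (G_int (l - m))"
  "onsager_bracket (G_int l) (A_elt m) = A_elt (m + l) - A_elt (m - l)"
  "onsager_bracket (A_elt m) (G_int l) = A_elt (m - l) - A_elt (m + l)"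
  "onsager_bracket (G_int l) (G_int m) = 0"
proof -
  show "onsager_bracket (A_elt l) (A_elt m) = onsager_scale 2 (G_int (l - m))"
    by (auto simp: A_elt_def onsager_bracket_single G_int_def)
  show *: "onsager_bracket (G_int l) (A_elt m) = A_elt (m + l) - A_elt (m - l)"
    by (auto simp: G_int_def onsager_bracket_G_A)
  show "onsager_bracket (A_elt m) (G_int l) = A_elt (m - l) - A_elt (m + l)"
    by (subst onsager_bracket_antisym) (simp add: *)
  show "onsager_bracket (G_int l) (G_int m) = 0"
    by (simp add: G_int_def onsager_bracket_G_G)
qed

lemma onsager_single_cases:
  obtains (A) m where "Poly_Mapping.single i a = onsager_scale a (A_elt m)"
  | (G) l where "Poly_Mapping.single i a = onsager_scale a (G_int l)"
proof (cases i)
  case (A_index m)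
  then show ?thesis using that(1)[of m] by (simp add: A_elt_def onsager_scale_single)
next
  case (G_index l)
  have "0 < Rep_pnat l" using Rep_pnat[of l] by simp
  then show ?thesis
    using that(2)[of "int (Rep_pnat l)"] G_index
    by (simp add: G_int_def G_elt_def onsager_scale_single Rep_pnat_inverse)
qed

lemma onsager_jacobi_int:
  fixes i j k :: onsager_index
  defines "J \<equiv> \<lambda>x y z :: 'k::field onsager. onsager_bracket x (onsager_bracket y z)
    + onsager_bracket y (onsager_bracket z x) + onsager_bracket z (onsager_bracket x y)"
  shows "J (Poly_Mapping.single i a) (Poly_Mapping.single j b) (Poly_Mapping.single k c) = 0"
proof -
  have sc: "J (onsager_scale a x) (onsager_scale b y) (onsager_scale c z) =
    onsager_scale (a * b * c) (J x y z)" for x y z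
    by (simp add: J_def onsager_bracket_scale_left onsager_bracket_scale_right
        onsager.scale_right_distrib mult_ac)
  note br = onsager_bracket_int onsager_bracket_scale_left onsager_bracket_scale_right
    onsager_bracket_diff
  have AAA: "J (A_elt l) (A_elt m) (A_elt n) = 0" for l m n
    by (simp add: J_def br algebra_simps)
  have rot: "J x y z = J y z x" for x y z by (simp add: J_def algebra_simps)
  have Gm: "G_int (- l) = - G_int l" for l by (simp add: G_int_def)
  have AAG: "J (A_elt l) (A_elt m) (G_int n) = 0" for l m n
  proof -
    have "G_int (m + n - l) = - (G_int (l - (m + n)) :: 'k onsager)"
      "G_int (m - (l + n)) = - (G_int (l + n - m) :: 'k onsager)"
      by (simp_all flip: Gm)
    then show ?thesis by (simp add: J_def br algebra_simps onsager.scale_minus_right)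
  qed
  have AGG: "J (A_elt l) (G_int m) (G_int n) = 0" for l m n
    by (simp add: J_def br algebra_simps)
  have AGA: "J (A_elt l) (G_int m) (A_elt n) = 0" and GAA: "J (G_int l) (A_elt m) (A_elt n) = 0"
    and GAG: "J (G_int l) (A_elt m) (G_int n) = 0" and GGA: "J (G_int l) (G_int m) (A_elt n) = 0"
    for l m n
    using AAG AGG rot by metis+
  have GGG: "J (G_int l) (G_int m) (G_int n) = 0" for l m n
    by (simp add: J_def br)
  show ?thesis
    by (cases i a rule: onsager_single_cases; cases j b rule: onsager_single_cases;
        cases k c rule: onsager_single_cases)
       (simp_all add: sc AAA AAG AGG GGG AGA GAA GAG GGA)
qed

lemma onsager_jacobi:
  "onsager_bracket x (onsager_bracket y z) + onsager_bracket y (onsager_bracket z x)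
    + onsager_bracket z (onsager_bracket x y) = 0" (is "?J x y z = 0")
proof -
  have J_add: "?J (x + x') y z = ?J x y z + ?J x' y z" "?J x (y + y') z = ?J x y z + ?J x y' z"
    "?J x y (z + z') = ?J x y z + ?J x y z'" for x x' y y' z z'
    by (simp_all add: onsager_bracket_add)
  show ?thesis
  proof (induction x rule: poly_mapping_add_induct)
    case (single i a)
    show ?case
    proof (induction y rule: poly_mapping_add_induct)
      case (single j b)
      show ?case
      proof (induction z rule: poly_mapping_add_induct)
        case (single k c)
        show ?case by (rule onsager_jacobi_int)
      next
        case (add z z')
        then show ?case by (simp only: J_add) simp
      qed simp
    next
      case (add z z')
      then show ?case by (simp only: J_add) simp
    qed simp
  next
    case (add z z')
    then show ?case by (simp only: J_add) simp
  qed simp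
qed

theorem lie_algebra_onsager: "lie_algebra (onsager_scale :: 'k::field \<Rightarrow> _) onsager_bracket"
  by (intro lie_algebra.intro vector_space_onsager lie_algebra_axioms.intro
      onsager_bracket_add onsager_bracket_scale_left onsager_bracket_scale_right
      onsager_bracket_self onsager_jacobi)


section \<open>The Lie algebra of traceless matrices\<close>

typedef (overloaded) ('k::field) sl2 = "{M :: 'k^2^2. trace M = 0}"
  morphisms mat_of_sl2 sl2_of_mat
  by (rule exI[of _ 0]) (simp add: trace_def)

setup_lifting type_definition_sl2

instantiation sl2 :: (field) ab_group_add
begin

lift_definition zero_sl2 :: "'a sl2" is 0
  by (simp add: trace_def)
lift_definition plus_sl2 :: "'a sl2 \<Rightarrow> 'a sl2 \<Rightarrow> 'a sl2" is "(+)"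
  by (simp add: trace_add)
lift_definition minus_sl2 :: "'a sl2 \<Rightarrow> 'a sl2 \<Rightarrow> 'a sl2" is "(-)"
  by (simp add: trace_sub)
lift_definition uminus_sl2 :: "'a sl2 \<Rightarrow> 'a sl2" is uminus
  by (simp add: trace_def sum_negf)

instance
  by standard (transfer; simp)+

end

lift_definition sl2_scale :: "'k::field \<Rightarrow> 'k sl2 \<Rightarrow> 'k sl2" is
  "\<lambda>c M. \<chi> i j. c * M $ i $ j"
  by (simp add: trace_def sum_distrib_left[symmetric])

lift_definition sl2_bracket :: "'k::field sl2 \<Rightarrow> 'k sl2 \<Rightarrow> 'k sl2" is
  "\<lambda>M N. M ** N - N ** M"
  by (simp add: trace_sub, rule trace_mul_sym)

lift_definition sl2_e :: "'k::field sl2" is "\<chi> i j. if i = 1 \<and> j = 2 then 1 else 0"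
  by (simp add: trace_def sum_2)

lift_definition sl2_f :: "'k::field sl2" is "\<chi> i j. if i = 2 \<and> j = 1 then 1 else 0"
  by (simp add: trace_def sum_2)

lift_definition sl2_h :: "'k::field sl2" is
  "\<chi> i j. if i = 1 \<and> j = 1 then 1 else if i = 2 \<and> j = 2 then -1 else 0"
  by (simp add: trace_def sum_2)

text \<open>The coordinates of \<open>M\<close> with respect to \<open>e, f, h\<close> are \<open>M\<^sub>1\<^sub>2, M\<^sub>2\<^sub>1, M\<^sub>1\<^sub>1\<close>, and
  \<open>e, f, h\<close> are sent to \<open>f, e, -h\<close>.\<close>

definition chevalley :: "'k::field sl2 \<Rightarrow> 'k sl2" where
  "chevalley x = sl2_scale (mat_of_sl2 x $ 1 $ 2) sl2_f + sl2_scale (mat_of_sl2 x $ 2 $ 1) sl2_e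
     - sl2_scale (mat_of_sl2 x $ 1 $ 1) sl2_h"

lemma mat_of_sl2_22: "mat_of_sl2 x $ 2 $ 2 = - mat_of_sl2 x $ 1 $ 1"
proof -
  have "trace (mat_of_sl2 x) = 0"
    using mat_of_sl2[of x] by simp
  then have "mat_of_sl2 x $ 1 $ 1 + mat_of_sl2 x $ 2 $ 2 = 0"
    by (simp only: trace_def sum_2)
  then show ?thesis
    by (simp only: add_eq_0_iff)
qed

lemma sl2_eqI:
  fixes x y :: "'k::field sl2"
  assumes "mat_of_sl2 x $ 1 $ 2 = mat_of_sl2 y $ 1 $ 2" "mat_of_sl2 x $ 2 $ 1 = mat_of_sl2 y $ 2 $ 1"
    "mat_of_sl2 x $ 1 $ 1 = mat_of_sl2 y $ 1 $ 1"
  shows "x = y"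
proof -
  have "mat_of_sl2 x = mat_of_sl2 y"
    using assms by (simp add: vec_eq_iff forall_2 mat_of_sl2_22)
  then show ?thesis by (simp add: mat_of_sl2_inject)
qed

lemmas mat_of_sl2_simps =
  zero_sl2.rep_eq plus_sl2.rep_eq minus_sl2.rep_eq uminus_sl2.rep_eq sl2_scale.rep_eq
  sl2_bracket.rep_eq sl2_e.rep_eq sl2_f.rep_eq sl2_h.rep_eq matrix_matrix_mult_def sum_2
  mat_of_sl2_22

lemma sl2_expand:
  "x = sl2_scale (mat_of_sl2 x $ 1 $ 2) sl2_e + sl2_scale (mat_of_sl2 x $ 2 $ 1) sl2_f
     + sl2_scale (mat_of_sl2 x $ 1 $ 1) sl2_h"
  by (rule sl2_eqI) (simp_all add: mat_of_sl2_simps)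

lemma sl2_bracket_basis:
  "sl2_bracket sl2_e sl2_f = sl2_h"
  "sl2_bracket sl2_h sl2_e = sl2_scale 2 sl2_e"
  "sl2_bracket sl2_h sl2_f = - sl2_scale 2 sl2_f"
  by (rule sl2_eqI; simp add: mat_of_sl2_simps)+

lemma lie_algebra_sl2: "lie_algebra (sl2_scale :: 'k::field \<Rightarrow> _) sl2_bracket"
  by standard (rule sl2_eqI; simp add: mat_of_sl2_simps algebra_simps)+

interpretation sl2: lie_algebra "sl2_scale :: 'k::field \<Rightarrow> _" sl2_bracket
  by (rule lie_algebra_sl2)

lemma chevalley_basis:
  "chevalley sl2_e = sl2_f" "chevalley sl2_f = sl2_e" "chevalley sl2_h = - sl2_h"
  by (rule sl2_eqI; simp add: chevalley_def mat_of_sl2_simps)+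

lemma linear_chevalley:
  "Vector_Spaces.linear sl2_scale sl2_scale (chevalley :: 'k::field sl2 \<Rightarrow> _)"
  by (intro Vector_Spaces.linear.intro module_hom.intro module_hom_axioms.intro
       sl2.vector_space_axioms sl2.module_axioms;
      rule sl2_eqI; simp add: chevalley_def mat_of_sl2_simps algebra_simps)+

lemma chevalley_bracket:
  "chevalley (sl2_bracket x y) = sl2_bracket (chevalley x) (chevalley y)"
  by (rule sl2_eqI; simp add: chevalley_def mat_of_sl2_simps algebra_simps)

lemma chevalley_chevalley [simp]: "chevalley (chevalley x) = x"
  by (rule sl2_eqI; simp add: chevalley_def mat_of_sl2_simps algebra_simps)

lemma chevalley_simps [simp]:
  "chevalley 0 = 0"
  "chevalley (x + y) = chevalley x + chevalley y"
  "chevalley (sl2_scale c x) = sl2_scale c (chevalley x)"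
  by (rule sl2_eqI; simp add: chevalley_def mat_of_sl2_simps algebra_simps)+


section \<open>The loop algebra\<close>

text \<open>\<open>int \<Rightarrow>\<^sub>0 'k\<close> with its convolution product is the ring of Laurent polynomials. As it has the
  basis \<open>t\<^sup>n\<close>, its tensor product with \<open>sl2\<close> is the direct sum of the copies \<open>t\<^sup>n \<otimes> sl2\<close>;
  \<open>tensor\<close> is the universal bilinear map, see \<open>tensor_universal\<close>. The bracket and \<open>omega\<close> are
  determined by \<open>loop_bracket_tensor\<close> and \<open>omega_tensor\<close>.\<close>

type_synonym 'k laurent = "int \<Rightarrow>\<^sub>0 'k"
type_synonym 'k loop = "int \<Rightarrow>\<^sub>0 'k sl2"

definition laurent_scale :: "'k::field \<Rightarrow> 'k laurent \<Rightarrow> 'k laurent" where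
  "laurent_scale c = Poly_Mapping.map ((*) c)"

definition loop_scale :: "'k::field \<Rightarrow> 'k loop \<Rightarrow> 'k loop" where
  "loop_scale c = Poly_Mapping.map (sl2_scale c)"

definition tensor :: "'k::field laurent \<Rightarrow> 'k sl2 \<Rightarrow> 'k loop" where
  "tensor p x = Poly_Mapping.map (\<lambda>c. sl2_scale c x) p"

definition loop_bracket :: "'k::field loop \<Rightarrow> 'k loop \<Rightarrow> 'k loop" where
  "loop_bracket =
     biadditive_ext (\<lambda>m n x y. Poly_Mapping.single (m + n) (sl2_bracket x y))"

definition laurent_inverse_var :: "'k::field laurent \<Rightarrow> 'k laurent" where
  "laurent_inverse_var p = Poly_Mapping.map_key uminus p"

definition omega :: "'k::field loop \<Rightarrow> 'k loop" where
  "omega X = Poly_Mapping.map chevalley (Poly_Mapping.map_key uminus X)"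

definition loop_fixed :: "'k::field loop set" where
  "loop_fixed = {X. omega X = X}"

lemma lookup_laurent_scale [simp]:
  "Poly_Mapping.lookup (laurent_scale c p) n = c * Poly_Mapping.lookup p n"
  by (simp add: laurent_scale_def lookup_map_zero)

lemma lookup_loop_scale [simp]:
  "Poly_Mapping.lookup (loop_scale c X) n = sl2_scale c (Poly_Mapping.lookup X n)"
  by (simp add: loop_scale_def lookup_map_zero)

lemma lookup_tensor [simp]:
  "Poly_Mapping.lookup (tensor p x) n = sl2_scale (Poly_Mapping.lookup p n) x"
  by (simp add: tensor_def lookup_map_zero)

lemma lookup_laurent_inverse_var [simp]:
  "Poly_Mapping.lookup (laurent_inverse_var p) n = Poly_Mapping.lookup p (- n)"
  by (simp add: laurent_inverse_var_def map_key.rep_eq)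

lemma lookup_omega [simp]:
  "Poly_Mapping.lookup (omega X) n = chevalley (Poly_Mapping.lookup X (- n))"
  by (simp add: omega_def lookup_map_zero map_key.rep_eq)

lemma tensor_single: "tensor (Poly_Mapping.single n c) x = Poly_Mapping.single n (sl2_scale c x)"
  by (simp add: tensor_def)

lemma tensor_zero [simp]: "tensor 0 x = 0"
  by (rule poly_mapping_eqI) simp

lemma single_eq_tensor: "Poly_Mapping.single n x = tensor (Poly_Mapping.single n 1) x"
  by (simp add: tensor_single)

lemma vector_space_laurent: "vector_space (laurent_scale :: 'k::field \<Rightarrow> _)"
  by standard (auto intro!: poly_mapping_eqI simp: lookup_add algebra_simps)

lemma vector_space_loop: "vector_space (loop_scale :: 'k::field \<Rightarrow> _)"
  by standard
    (auto intro!: poly_mapping_eqI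
       simp: lookup_add sl2.scale_right_distrib sl2.scale_left_distrib)

interpretation laurent: vector_space "laurent_scale :: 'k::field \<Rightarrow> _"
  by (rule vector_space_laurent)

interpretation loop: vector_space "loop_scale :: 'k::field \<Rightarrow> _"
  by (rule vector_space_loop)

lemma tensor_bilinear:
  "tensor (p + q) x = tensor p x + tensor q x"
  "tensor p (x + y) = tensor p x + tensor p y"
  "tensor (laurent_scale c p) x = loop_scale c (tensor p x)"
  "tensor p (sl2_scale c x) = loop_scale c (tensor p x)"
  by (auto intro!: poly_mapping_eqI
       simp: lookup_add sl2.scale_right_distrib sl2.scale_left_distrib mult.commute)

theorem tensor_universal:
  fixes scale :: "'k::field \<Rightarrow> 'w::ab_group_add \<Rightarrow> 'w" and B :: "'k laurent \<Rightarrow> 'k sl2 \<Rightarrow> 'w"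
  assumes "vector_space scale"
    and "\<And>x. Vector_Spaces.linear laurent_scale scale (\<lambda>p. B p x)"
    and "\<And>p. Vector_Spaces.linear sl2_scale scale (B p)"
  shows "\<exists>!F. Vector_Spaces.linear loop_scale scale F \<and> (\<forall>p x. F (tensor p x) = B p x)"
proof (rule ex_ex1I)
  interpret W: vector_space scale by fact
  interpret B1: Vector_Spaces.linear laurent_scale scale "\<lambda>p. B p x" for x by fact
  interpret B2: Vector_Spaces.linear sl2_scale scale "B p" for p by fact
  define F where "F X = (\<Sum>n\<in>Poly_Mapping.keys X.
    B (Poly_Mapping.single n 1) (Poly_Mapping.lookup X n))" for X
  have F_super: "F X = (\<Sum>n\<in>I. B (Poly_Mapping.single n 1) (Poly_Mapping.lookup X n))"
    if "finite I" "Poly_Mapping.keys X \<subseteq> I" for X I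
    unfolding F_def using that
    by (intro sum.mono_neutral_left) (auto simp: in_keys_iff B2.zero)
  have F_add: "F (X + Y) = F X + F Y" for X Y
    using keys_add[of X Y]
    by (simp add: F_super[of "Poly_Mapping.keys X \<union> Poly_Mapping.keys Y"]
        lookup_add B2.add sum.distrib)
  have "Poly_Mapping.keys (loop_scale c X) \<subseteq> Poly_Mapping.keys X" for c and X :: "'k loop"
    by (auto simp: in_keys_iff)
  then have F_scale: "F (loop_scale c X) = scale c (F X)" for c X
    by (simp add: F_super[of "Poly_Mapping.keys X"] B2.scale W.scale_sum_right)
  have "F (tensor p x) = B p x" for p x
  proof (induction p rule: poly_mapping_add_induct)
    case zero
    show ?case by (simp add: F_def B1.zero)
  next
    case (single n c)
    have "F (tensor (Poly_Mapping.single n c) x) = scale c (B (Poly_Mapping.single n 1) x)"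
      by (simp add: tensor_single F_super[of "{n}"] B2.scale)
    also have "\<dots> = B (Poly_Mapping.single n c) x"
      by (simp flip: B1.scale add: laurent_scale_def)
    finally show ?case .
  next
    case (add p q)
    then show ?case by (simp add: tensor_bilinear F_add B1.add)
  qed
  moreover have "Vector_Spaces.linear loop_scale scale F"
    by (intro Vector_Spaces.linear.intro module_hom.intro module_hom_axioms.intro
        loop.vector_space_axioms loop.module_axioms W.vector_space_axioms W.module_axioms
        F_add F_scale)
  ultimately show "\<exists>F. Vector_Spaces.linear loop_scale scale F \<and> (\<forall>p x. F (tensor p x) = B p x)"
    by blast
next
  fix F F'
  assume F: "Vector_Spaces.linear loop_scale scale F \<and> (\<forall>p x. F (tensor p x) = B p x)"
    and F': "Vector_Spaces.linear loop_scale scale F' \<and> (\<forall>p x. F' (tensor p x) = B p x)"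
  interpret F: Vector_Spaces.linear loop_scale scale F using F by simp
  interpret F': Vector_Spaces.linear loop_scale scale F' using F' by simp
  show "F = F'"
  proof
    fix X show "F X = F' X"
      by (induction X rule: poly_mapping_add_induct)
         (simp_all add: F.zero F'.zero F.add F'.add single_eq_tensor F F')
  qed
qed

lemma loop_bracket_add:
  "loop_bracket (X + Y) Z = loop_bracket X Z + loop_bracket Y Z"
  "loop_bracket X (Y + Z) = loop_bracket X Y + loop_bracket X Z"
  unfolding loop_bracket_def
  by (intro biadditive_ext_add_left biadditive_ext_add_right;
      simp add: sl2.bracket_add_left sl2.bracket_add_right single_add)+

lemma loop_bracket_zero [simp]: "loop_bracket 0 Y = 0" "loop_bracket X 0 = 0"
  by (simp_all add: loop_bracket_def)

lemma sl2_bracket_zero [simp]: "sl2_bracket 0 y = 0" "sl2_bracket x 0 = 0"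
  using sl2.bracket_add_left[of 0 0 y] sl2.bracket_add_right[of x 0 0] by simp_all

lemma loop_bracket_single:
  "loop_bracket (Poly_Mapping.single m x) (Poly_Mapping.single n y) =
     Poly_Mapping.single (m + n) (sl2_bracket x y)"
  unfolding loop_bracket_def by (rule biadditive_ext_single) simp_all

theorem loop_bracket_tensor:
  "loop_bracket (tensor p x) (tensor q y) = tensor (p * q) (sl2_bracket x y)"
proof (induction p rule: poly_mapping_add_induct)
  case (single m a)
  show ?case
    by (induction q rule: poly_mapping_add_induct)
       (simp_all add: tensor_single loop_bracket_single mult_single sl2.bracket_scale_left
         sl2.bracket_scale_right tensor_bilinear loop_bracket_add distrib_left mult.commute[of a])
qed (simp_all add: tensor_bilinear loop_bracket_add distrib_right)

theorem omega_tensor: "omega (tensor p x) = tensor (laurent_inverse_var p) (chevalley x)"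
  by (rule poly_mapping_eqI) simp

lemma laurent_inverse_var_single:
  "laurent_inverse_var (Poly_Mapping.single n c) = Poly_Mapping.single (- n) c"
  by (rule poly_mapping_eqI) (auto simp: lookup_single when_def)

lemma omega_single: "omega (Poly_Mapping.single n x) = Poly_Mapping.single (- n) (chevalley x)"
  by (rule poly_mapping_eqI) (auto simp: lookup_single when_def)

lemma omega_add: "omega (X + Y) = omega X + omega Y"
  by (rule poly_mapping_eqI) (simp add: lookup_add)

lemma omega_scale: "omega (loop_scale c X) = loop_scale c (omega X)"
  by (rule poly_mapping_eqI) simp

lemma omega_zero [simp]: "omega 0 = 0"
  by (rule poly_mapping_eqI) simp

lemma omega_omega [simp]: "omega (omega X) = X"
  by (rule poly_mapping_eqI) simp

theorem omega_bracket: "omega (loop_bracket X Y) = loop_bracket (omega X) (omega Y)"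
proof (induction X rule: poly_mapping_add_induct)
  case (single m x)
  show ?case
    by (induction Y rule: poly_mapping_add_induct)
       (simp_all add: omega_single loop_bracket_single chevalley_bracket omega_add
         loop_bracket_add add.commute)
qed (simp_all add: omega_add loop_bracket_add)

lemma loop_scale_single:
  "loop_scale c (Poly_Mapping.single n x) = Poly_Mapping.single n (sl2_scale c x)"
  by (simp add: loop_scale_def)

lemma loop_bracket_scale:
  "loop_bracket (loop_scale c X) Y = loop_scale c (loop_bracket X Y)"
  "loop_bracket X (loop_scale c Y) = loop_scale c (loop_bracket X Y)"
proof -
  have "loop_bracket (loop_scale c X) Y = loop_scale c (loop_bracket X Y) \<and>
    loop_bracket X (loop_scale c Y) = loop_scale c (loop_bracket X Y)"
  proof (induction X rule: poly_mapping_add_induct)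
    case (single m x)
    show ?case
      by (induction Y rule: poly_mapping_add_induct)
         (simp_all add: loop_scale_single loop_bracket_single sl2.bracket_scale_left
           sl2.bracket_scale_right loop_bracket_add loop.scale_right_distrib)
  qed (simp_all add: loop_bracket_add loop.scale_right_distrib)
  then show "loop_bracket (loop_scale c X) Y = loop_scale c (loop_bracket X Y)"
    "loop_bracket X (loop_scale c Y) = loop_scale c (loop_bracket X Y)"
    by simp_all
qed

lemma sl2_bracket_antisym: "sl2_bracket x y = - sl2_bracket y x"
  by (rule sl2_eqI) (simp_all add: mat_of_sl2_simps)

lemma loop_bracket_antisym: "loop_bracket X Y = - loop_bracket Y X"
proof (induction X rule: poly_mapping_add_induct)
  case (single m x)
  show ?case
  proof (induction Y rule: poly_mapping_add_induct)
    case (single n y)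
    show ?case
      by (simp add: loop_bracket_single add.commute sl2_bracket_antisym[of x y]
          flip: single_uminus)
  qed (simp_all add: loop_bracket_add)
qed (simp_all add: loop_bracket_add)

lemma loop_bracket_self: "loop_bracket X X = 0"
proof (induction X rule: poly_mapping_add_induct)
  case (add X Y)
  then show ?case
    using loop_bracket_antisym[of X Y] by (simp add: loop_bracket_add)
qed (simp_all add: loop_bracket_single sl2.bracket_self)

lemma loop_jacobi:
  "loop_bracket X (loop_bracket Y Z) + loop_bracket Y (loop_bracket Z X)
    + loop_bracket Z (loop_bracket X Y) = 0" (is "?J X Y Z = 0")
proof -
  have J_add: "?J (X + X') Y Z = ?J X Y Z + ?J X' Y Z" "?J X (Y + Y') Z = ?J X Y Z + ?J X Y' Z"
    "?J X Y (Z + Z') = ?J X Y Z + ?J X Y Z'" for X X' Y Y' Z Z'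
    by (simp_all add: loop_bracket_add)
  show ?thesis
  proof (induction X rule: poly_mapping_add_induct)
    case (single l x)
    show ?case
    proof (induction Y rule: poly_mapping_add_induct)
      case (single m y)
      show ?case
      proof (induction Z rule: poly_mapping_add_induct)
        case (single n z)
        have "m + (n + l) = l + (m + n)" "n + (l + m) = l + (m + n)" by simp_all
        then show ?case
          by (simp only: loop_bracket_single single_add[symmetric] sl2.jacobi single_zero)
      next
        case (add Z Z')
        then show ?case by (simp only: J_add) simp
      qed simp
    next
      case (add Y Y')
      then show ?case by (simp only: J_add) simp
    qed simp
  next
    case (add X X')
    then show ?case by (simp only: J_add) simp
  qed simp
qed

theorem lie_algebra_loop: "lie_algebra (loop_scale :: 'k::field \<Rightarrow> _) loop_bracket"
  by (intro lie_algebra.intro vector_space_loop lie_algebra_axioms.intro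
      loop_bracket_add loop_bracket_scale loop_bracket_self loop_jacobi)

interpretation loop: lie_algebra "loop_scale :: 'k::field \<Rightarrow> _" loop_bracket
  by (rule lie_algebra_loop)

theorem lie_subalgebra_loop_fixed: "loop.lie_subalgebra (loop_fixed :: 'k::field loop set)"
  by (auto simp: loop.lie_subalgebra_def loop.subspace_def loop_fixed_def omega_add omega_scale
      omega_bracket)

end

theory Submission
  imports Defs
begin

text \<open>The isomorphism is
  \<open>A\<^sub>m \<mapsto> t\<^sup>m \<otimes> e + t\<^sup>-\<^sup>m \<otimes> f\<close> and \<open>G\<^sub>l \<mapsto> 1/2 (t\<^sup>l - t\<^sup>-\<^sup>l) \<otimes> h\<close>.
  The first family is \<open>\<omega>\<close>-invariant by inspection, and the second is then forced by
  \<open>[A\<^sub>l, A\<^sub>m] = 2 G\<^sub>l\<^sub>-\<^sub>m\<close>. With the convention \<open>G\<^sub>0 = 0\<close>, \<open>G\<^sub>-\<^sub>l = - G\<^sub>l\<close> the relations hold for all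
  integer indices, and so do those of the images: since both brackets are bilinear, the
  homomorphism property is a computation with \<open>[e, f] = h\<close>, \<open>[h, e] = 2e\<close>, \<open>[h, f] = -2f\<close>
  (\<open>loop_bracket_images\<close>).

  For bijectivity write an element of the loop algebra as \<open>\<Sum>\<^sub>n t\<^sup>n \<otimes> (a\<^sub>n e + b\<^sub>n f + c\<^sub>n h)\<close>. It is
  fixed by \<open>\<omega>\<close> iff \<open>b\<^sub>n = a\<^sub>-\<^sub>n\<close> and \<open>c\<^sub>-\<^sub>n = - c\<^sub>n\<close> for all \<open>n\<close>; the latter forces \<open>c\<^sub>0 = 0\<close> because
  \<open>2\<close> is invertible. Hence a fixed element is the same as an arbitrary choice of finitely many
  nonzero \<open>a\<^sub>n\<close> (\<open>n\<close> an integer) and \<open>c\<^sub>n\<close> (\<open>n > 0\<close>), and these are, up to the factor \<open>2\<close>, the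
  coordinates with respect to the \<open>A\<^sub>n\<close> and \<open>G\<^sub>n\<close> (\<open>coordinates_onsager_to_loop\<close>).\<close>


section \<open>The linear map\<close>

definition loop_A :: "int \<Rightarrow> 'k::field loop" where
  "loop_A m = Poly_Mapping.single m sl2_e + Poly_Mapping.single (- m) sl2_f"

text \<open>The index ranges over all integers, so that \<open>loop_G\<close> is odd in it like \<open>G_int\<close> and no case
  distinction on the order of the indices enters the bracket computations.\<close>

definition loop_G :: "int \<Rightarrow> 'k::field loop" where
  "loop_G l = Poly_Mapping.single l (sl2_scale (1 / 2) sl2_h)
     - Poly_Mapping.single (- l) (sl2_scale (1 / 2) sl2_h)"

fun onsager_basis_image :: "onsager_index \<Rightarrow> 'k::field loop" where
  "onsager_basis_image (A_index m) = loop_A m"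
| "onsager_basis_image (G_index l) = loop_G (int (Rep_pnat l))"

definition onsager_to_loop :: "'k::field onsager \<Rightarrow> 'k loop" where
  "onsager_to_loop x = (\<Sum>i\<in>Poly_Mapping.keys x.
     loop_scale (Poly_Mapping.lookup x i) (onsager_basis_image i))"

lemma onsager_to_loop_superset:
  assumes "finite I" "Poly_Mapping.keys x \<subseteq> I"
  shows "onsager_to_loop x =
    (\<Sum>i\<in>I. loop_scale (Poly_Mapping.lookup x i) (onsager_basis_image i))"
  unfolding onsager_to_loop_def using assms
  by (intro sum.mono_neutral_left) (auto simp: in_keys_iff)

lemma onsager_to_loop_add:
  "onsager_to_loop (x + y) = onsager_to_loop x + onsager_to_loop y"
  using keys_add[of x y]
  by (simp add: onsager_to_loop_superset[of "Poly_Mapping.keys x \<union> Poly_Mapping.keys y"]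
      lookup_add loop.scale_left_distrib sum.distrib)

lemma onsager_to_loop_scale:
  "onsager_to_loop (onsager_scale c x) = loop_scale c (onsager_to_loop x)"
proof -
  have "Poly_Mapping.keys (onsager_scale c x) \<subseteq> Poly_Mapping.keys x"
    by (auto simp: in_keys_iff)
  then show ?thesis
    by (simp add: onsager_to_loop_superset[of "Poly_Mapping.keys x"] loop.scale_sum_right)
qed

lemma linear_onsager_to_loop:
  "Vector_Spaces.linear onsager_scale loop_scale (onsager_to_loop :: 'k::field onsager \<Rightarrow> _)"
  by (intro Vector_Spaces.linear.intro module_hom.intro module_hom_axioms.intro
      onsager.vector_space_axioms onsager.module_axioms loop.vector_space_axioms
      loop.module_axioms onsager_to_loop_add onsager_to_loop_scale)

interpretation onsager_to_loop: Vector_Spaces.linear onsager_scale loop_scale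
    "onsager_to_loop :: 'k::field onsager \<Rightarrow> _"
  by (rule linear_onsager_to_loop)

lemma onsager_to_loop_single:
  "onsager_to_loop (Poly_Mapping.single i a) = loop_scale a (onsager_basis_image i)"
  by (simp add: onsager_to_loop_superset[of "{i}"])

lemma onsager_to_loop_A_elt: "onsager_to_loop (A_elt m) = loop_A m"
  by (simp add: A_elt_def onsager_to_loop_single)

lemma onsager_to_loop_G_int: "onsager_to_loop (G_int l) = loop_G l"
  by (simp add: G_int_def G_elt_def onsager_to_loop_single onsager_to_loop.neg
      Abs_pnat_inverse loop_G_def)


section \<open>Compatibility with the brackets\<close>

lemma sl2_bracket_basis_flipped:
  "sl2_bracket sl2_f sl2_e = - sl2_h"
  "sl2_bracket sl2_e sl2_h = - sl2_scale 2 sl2_e"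
  "sl2_bracket sl2_f sl2_h = sl2_scale 2 sl2_f"
  by (subst sl2_bracket_antisym; simp add: sl2_bracket_basis)+

lemma loop_bracket_diff:
  "loop_bracket (X - Y) Z = loop_bracket X Z - loop_bracket Y Z"
  "loop_bracket X (Y - Z) = loop_bracket X Y - loop_bracket X Z"
  using loop_bracket_add(1)[of "X - Y" Y Z] loop_bracket_add(2)[of X "Y - Z" Z] by simp_all

lemma loop_bracket_images:
  fixes l m :: int
  shows "loop_bracket (loop_A l) (loop_A m) = (loop_scale 2 (loop_G (l - m)) :: 'k::field_char_0 loop)"
    and "loop_bracket (loop_G l) (loop_A m) = (loop_A (m + l) - loop_A (m - l) :: 'k loop)"
    and "loop_bracket (loop_A m) (loop_G l) = (loop_A (m - l) - loop_A (m + l) :: 'k loop)"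
    and "loop_bracket (loop_G l) (loop_G m) = (0 :: 'k loop)"
proof -
  note expand = loop_A_def loop_G_def loop_bracket_add loop_bracket_diff loop_bracket_single
    sl2.bracket_scale_left sl2.bracket_scale_right sl2.bracket_self
    sl2_bracket_basis sl2_bracket_basis_flipped
    loop.scale_right_diff_distrib loop_scale_single sl2.scale_minus_right single_uminus
  show "loop_bracket (loop_A l) (loop_A m) = (loop_scale 2 (loop_G (l - m)) :: 'k loop)"
    by (simp add: expand)
  show *: "loop_bracket (loop_G l) (loop_A m) = (loop_A (m + l) - loop_A (m - l) :: 'k loop)"
    by (simp add: expand algebra_simps)
  show "loop_bracket (loop_A m) (loop_G l) = (loop_A (m - l) - loop_A (m + l) :: 'k loop)"
    by (subst loop_bracket_antisym) (simp add: *)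
  show "loop_bracket (loop_G l) (loop_G m) = (0 :: 'k loop)"
    by (simp add: expand)
qed

theorem onsager_to_loop_bracket:
  fixes x y :: "'k::field_char_0 onsager"
  shows "onsager_to_loop (onsager_bracket x y) =
    loop_bracket (onsager_to_loop x) (onsager_to_loop y)"
proof (induction x rule: poly_mapping_add_induct)
  case (single i a)
  show ?case
  proof (induction y rule: poly_mapping_add_induct)
    case (single j b)
    show ?case
      by (cases i a rule: onsager_single_cases; cases j b rule: onsager_single_cases)
         (simp_all add: onsager_bracket_scale_left onsager_bracket_scale_right
           onsager_bracket_int loop_bracket_scale loop_bracket_images onsager_to_loop.scale
           onsager_to_loop.diff onsager_to_loop_A_elt onsager_to_loop_G_int)
  qed (simp_all add: onsager_bracket_add loop_bracket_add onsager_to_loop.add)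
qed (simp_all add: onsager_bracket_add loop_bracket_add onsager_to_loop.add)


section \<open>The image is the fixed subalgebra\<close>

text \<open>The coefficients of the \<open>G\<^sub>n\<close>, extended to an odd function of an integer index: as \<open>G\<^sub>l\<close> is sent
  to \<open>1/2 (t\<^sup>l - t\<^sup>-\<^sup>l) \<otimes> h\<close>, the \<open>t\<^sup>n \<otimes> h\<close>-coordinate of an image is half of this number for every
  \<open>n\<close>.\<close>

definition onsager_G_coeff :: "'k::field onsager \<Rightarrow> int \<Rightarrow> 'k" where
  "onsager_G_coeff x n =
     (if 0 < n then Poly_Mapping.lookup x (G_index (Abs_pnat (nat n)))
      else if n < 0 then - Poly_Mapping.lookup x (G_index (Abs_pnat (nat (- n)))) else 0)"

lemma Abs_pnat_eq_iff: "0 < n \<Longrightarrow> Abs_pnat n = l \<longleftrightarrow> n = Rep_pnat l"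
  by (metis Abs_pnat_inverse Rep_pnat_inverse mem_Collect_eq)

lemma Rep_pnat_pos: "0 < Rep_pnat l"
  using Rep_pnat[of l] by simp

text \<open>This reduces injectivity and the description of the range to comparing coefficients. All three
  sides are additive in \<open>x\<close>, so it suffices to check basis elements.\<close>

lemma coordinates_onsager_to_loop:
  fixes x :: "'k::field onsager" and n :: int
  defines "M \<equiv> mat_of_sl2 (Poly_Mapping.lookup (onsager_to_loop x) n)"
  shows "M $ 1 $ 2 = Poly_Mapping.lookup x (A_index n)"
    and "M $ 2 $ 1 = Poly_Mapping.lookup x (A_index (- n))"
    and "M $ 1 $ 1 = onsager_G_coeff x n / 2"
proof -
  have "M $ 1 $ 2 = Poly_Mapping.lookup x (A_index n) \<and>
    M $ 2 $ 1 = Poly_Mapping.lookup x (A_index (- n)) \<and> M $ 1 $ 1 = onsager_G_coeff x n / 2"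
    unfolding M_def
  proof (induction x rule: poly_mapping_add_induct)
    case zero
    show ?case by (simp add: onsager_to_loop.zero onsager_G_coeff_def mat_of_sl2_simps)
  next
    case (single i a)
    show ?case
    proof (cases i)
      case (A_index m)
      then show ?thesis
        by (auto simp: onsager_to_loop_single loop_A_def lookup_add lookup_single when_def
            onsager_G_coeff_def mat_of_sl2_simps)
    next
      case (G_index l)
      have "0 < Rep_pnat l" by (rule Rep_pnat_pos)
      with G_index show ?thesis
        by (auto simp: onsager_to_loop_single loop_G_def lookup_minus lookup_single when_def
            onsager_G_coeff_def mat_of_sl2_simps Abs_pnat_eq_iff eq_commute[of l])
    qed
  next
    case (add x y)
    then show ?case
      by (simp add: onsager_to_loop.add lookup_add mat_of_sl2_simps onsager_G_coeff_def
          add_divide_distrib)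
  qed
  then show "M $ 1 $ 2 = Poly_Mapping.lookup x (A_index n)"
    and "M $ 2 $ 1 = Poly_Mapping.lookup x (A_index (- n))"
    and "M $ 1 $ 1 = onsager_G_coeff x n / 2" by blast+
qed

lemma mat_of_chevalley:
  "mat_of_sl2 (chevalley x) $ 1 $ 2 = mat_of_sl2 x $ 2 $ 1"
  "mat_of_sl2 (chevalley x) $ 2 $ 1 = mat_of_sl2 x $ 1 $ 2"
  "mat_of_sl2 (chevalley x) $ 1 $ 1 = - mat_of_sl2 x $ 1 $ 1"
  by (simp_all add: chevalley_def mat_of_sl2_simps)

lemma inj_onsager_to_loop: "inj (onsager_to_loop :: 'k::field_char_0 onsager \<Rightarrow> _)"
proof (rule injI, rule poly_mapping_eqI)
  fix x y :: "'k onsager" and i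
  assume eq: "onsager_to_loop x = onsager_to_loop y"
  show "Poly_Mapping.lookup x i = Poly_Mapping.lookup y i"
  proof (cases i)
    case (A_index m)
    then show ?thesis by (metis coordinates_onsager_to_loop(1) eq)
  next
    case (G_index l)
    have "onsager_G_coeff x (int (Rep_pnat l)) / 2 = onsager_G_coeff y (int (Rep_pnat l)) / 2"
      by (metis coordinates_onsager_to_loop(3) eq)
    then show ?thesis
      using G_index Rep_pnat_pos[of l] by (simp add: onsager_G_coeff_def Rep_pnat_inverse)
  qed
qed

lemma onsager_to_loop_in_fixed: "onsager_to_loop x \<in> (loop_fixed :: 'k::field loop set)"
  unfolding loop_fixed_def
  by (auto intro!: poly_mapping_eqI sl2_eqI
      simp: mat_of_chevalley coordinates_onsager_to_loop onsager_G_coeff_def)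

text \<open>A preimage is read off from half of the coordinates of \<open>X\<close>: the \<open>e\<close>-coordinates in all degrees
  and twice the \<open>h\<close>-coordinates in positive degrees. Invariance under \<open>omega\<close> recovers the
  others.\<close>

lemma loop_fixed_subset_range:
  fixes X :: "'k::field_char_0 loop"
  assumes "X \<in> loop_fixed"
  shows "X \<in> range onsager_to_loop"
proof -
  define c where "c i = (case i of
      A_index m \<Rightarrow> mat_of_sl2 (Poly_Mapping.lookup X m) $ 1 $ 2
    | G_index l \<Rightarrow> 2 * mat_of_sl2 (Poly_Mapping.lookup X (int (Rep_pnat l))) $ 1 $ 1)" for i
  have "i \<in> A_index ` Poly_Mapping.keys X \<union> (G_index \<circ> Abs_pnat \<circ> nat) ` Poly_Mapping.keys X"
    if "c i \<noteq> 0" for i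
  proof (cases i)
    case (A_index m)
    with that have "m \<in> Poly_Mapping.keys X"
      by (auto simp: c_def in_keys_iff mat_of_sl2_simps)
    then show ?thesis using A_index by simp
  next
    case (G_index l)
    with that have "int (Rep_pnat l) \<in> Poly_Mapping.keys X"
      by (auto simp: c_def in_keys_iff mat_of_sl2_simps)
    then show ?thesis
      using G_index by (auto simp: Rep_pnat_inverse intro!: rev_image_eqI)
  qed
  then have "{i. c i \<noteq> 0} \<subseteq>
      A_index ` Poly_Mapping.keys X \<union> (G_index \<circ> Abs_pnat \<circ> nat) ` Poly_Mapping.keys X"
    by blast
  then have "finite {i. c i \<noteq> 0}"
    by (rule finite_subset) simp
  then have lookup_c: "Poly_Mapping.lookup (Abs_poly_mapping c) = c"
    by (rule lookup_Abs_poly_mapping)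
  have "chevalley (Poly_Mapping.lookup X (- n)) = Poly_Mapping.lookup X n" for n
    using assms lookup_omega[of X n] by (simp add: loop_fixed_def)
  then have sym: "mat_of_sl2 (Poly_Mapping.lookup X (- n)) $ 1 $ 2 =
        mat_of_sl2 (Poly_Mapping.lookup X n) $ 2 $ 1"
      "mat_of_sl2 (Poly_Mapping.lookup X (- n)) $ 1 $ 1 =
        - mat_of_sl2 (Poly_Mapping.lookup X n) $ 1 $ 1" for n
    by (metis mat_of_chevalley(2), metis mat_of_chevalley(3) minus_minus)
  \<comment> \<open>The \<open>h\<close>-coordinate in degree \<open>0\<close> equals its own negative, so it vanishes as \<open>2 \<noteq> 0\<close>;
    the image of the \<open>G\<^sub>l\<close> has nothing in that degree.\<close>
  have sym0: "mat_of_sl2 (Poly_Mapping.lookup X 0) $ 1 $ 1 = 0"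
    using sym(2)[of 0] by simp
  have "onsager_G_coeff (Abs_poly_mapping c) n = 2 * mat_of_sl2 (Poly_Mapping.lookup X n) $ 1 $ 1"
    for n
    by (cases n "0 :: int" rule: linorder_cases)
       (simp_all add: onsager_G_coeff_def lookup_c c_def Abs_pnat_inverse sym sym0)
  then have "onsager_to_loop (Abs_poly_mapping c) = X"
    by (intro poly_mapping_eqI sl2_eqI)
       (simp_all add: coordinates_onsager_to_loop lookup_c c_def sym)
  then show ?thesis by blast
qed

theorem lemma3p2p4:
  shows "lie_isomorphic_to_subalgebra
    (onsager_scale :: 'k::{alg_closed_field, field_char_0} \<Rightarrow> 'k onsager \<Rightarrow> 'k onsager)
    onsager_bracket
    (loop_scale :: 'k \<Rightarrow> 'k loop \<Rightarrow> 'k loop) loop_bracket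
    (loop_fixed :: 'k loop set)"
proof -
  have "bij_betw (onsager_to_loop :: 'k onsager \<Rightarrow> _) UNIV loop_fixed"
    using inj_onsager_to_loop onsager_to_loop_in_fixed loop_fixed_subset_range
    by (auto simp: bij_betw_def)
  then show ?thesis
    unfolding lie_isomorphic_to_subalgebra_def
    using lie_algebra_onsager lie_algebra_loop lie_subalgebra_loop_fixed
      linear_onsager_to_loop onsager_to_loop_bracket by blast
qed

end
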